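(* Define the sequence $c$ by $c(1)=2$ and, for $n\ge 2$, $$c(n)=c(n-1)+\begin{cases}\gcd(n,\,c(n-1)), & n \text{ even},\\ \gcd(n-2,\,c(n-1)), & n\text{ odd}.\end{cases}$$ Call $n$ a fundamental point if $c(n)=2n$. Let $6\le m_j<m_{j+1}$ be adjacent fundamental points (no fundamental point lies strictly between them) such that the only integer $n$ with $m_j<n<m_{j+1}$ and $c(n)-c(n-1)>1$ is $n=m_j+3$ (the main increment). Then (i) $m_{j+1}=2m_j$; (ii) if $m_j-1$ and $m_j+1$ are twin primes, then $m_{j+1}-1$ and $m_{j+1}+1$ are twin primes as well.
   Context: The increment $c(m_j+3)-c(m_j+2)$ at a fundamental point $m_j$ is called the main increment. *)

theory Defs
  imports Main "HOL-Computational_Algebra.Primes"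
begin

(* The sequence is indexed from 1; the value at 0 is a dummy. *)
fun cseq :: "nat \<Rightarrow> nat" where
  "cseq n =
    (if n \<le> 1 then 2
     else cseq (n - 1) +
       (if even n then gcd n (cseq (n - 1)) else gcd (n - 2) (cseq (n - 1))))"

declare cseq.simps [simp del]

definition fundamental_point :: "nat \<Rightarrow> bool" where
  "fundamental_point n \<longleftrightarrow> n \<ge> 1 \<and> cseq n = 2 * n"

definition adjacent_fundamental_points :: "nat \<Rightarrow> nat \<Rightarrow> bool" where
  "adjacent_fundamental_points m m' \<longleftrightarrow>
     fundamental_point m \<and> fundamental_point m' \<and> m < m' \<and>
     (\<forall>n. m < n \<and> n < m' \<longrightarrow> \<not> fundamental_point n)"

definition twin_primes :: "nat \<Rightarrow> nat \<Rightarrow> bool" where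
  "twin_primes p q \<longleftrightarrow> prime p \<and> prime q \<and> q = p + 2"

end

theory Submission imports Defs begin

text \<open>
  Past the main increment the sequence is \<open>c(n) = 2m + n\<close>, so as long as the increments stay 1 the
  next fundamental point can only be \<open>2m\<close>. An increment 1 at \<open>n\<close> says that \<open>n\<close> is coprime to
  \<open>2m - 1\<close> (\<open>n\<close> even) or that \<open>n - 2\<close> is coprime to \<open>2m + 1\<close> (\<open>n\<close> odd). If \<open>2m - 1 = pq\<close> or
  \<open>2m + 1 = pq\<close> with \<open>3 \<le> p \<le> q\<close>, then the multiple \<open>p(q - 1)\<close> respectively \<open>p(q - 2)\<close> of \<open>p\<close>
  violates this.
\<close>

lemma cseq_rec:
  assumes "n \<ge> 2"
  shows "cseq n = cseq (n - 1) +
    (if even n then gcd n (cseq (n - 1)) else gcd (n - 2) (cseq (n - 1)))"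
  using assms cseq.simps[of n] by simp

text \<open>Every increment is a positive gcd: its first argument \<open>n\<close> or
  \<open>n - 2\<close> is nonzero, since an odd \<open>n\<close> is at least 3 here.\<close>

lemma cseq_less:
  assumes "n \<ge> 2"
  shows "cseq (n - 1) < cseq n"
  using assms cseq_rec[of n] by (auto simp: gcd_nat.neutr_eq_iff intro!: gr0I)

lemma odd_composite_factors:
  fixes n :: nat
  assumes "odd n" "n > 1" "\<not> prime n"
  obtains p q where "n = p * q" "3 \<le> p" "p \<le> q"
proof -
  obtain a b where ab: "n = a * b" "a \<noteq> 1" "b \<noteq> 1"
    using assms by (auto simp: prime_nat_iff)
  have "odd a" "odd b" using ab assms by auto
  hence "a \<ge> 3" "b \<ge> 3" using ab(2,3) by presburger+
  with ab show thesis using that[of a b] that[of b a] by (cases "a \<le> b") (auto simp: mult.commute)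
qed

lemma prime_double_minus_one:
  fixes m :: nat
  assumes m: "m \<ge> 6" "even m"
    and coprime: "\<And>n. m + 3 < n \<Longrightarrow> n < 2 * m \<Longrightarrow> even n \<Longrightarrow> coprime n (2 * m - 1)"
  shows "prime (2 * m - 1)"
proof (rule ccontr)
  have odd: "odd (2 * m - 1)" using m by presburger
  have "2 * m - 1 > 1" using m(1) by linarith
  moreover assume "\<not> prime (2 * m - 1)"
  ultimately obtain p q where pq: "2 * m - 1 = p * q" "3 \<le> p" "p \<le> q"
    using odd_composite_factors[OF odd] by metis
  have odd: "odd (p * q)" using odd unfolding pq(1) .
  \<comment> \<open>This is exactly what puts the witness \<open>p * (q - 1) = 2 * m - 1 - p\<close>
    above \<open>m + 3\<close>.\<close>
  have "p + 5 \<le> m"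
  proof (cases "p \<ge> 5")
    case True
    then obtain k where "p = 5 + k" using le_Suc_ex by blast
    moreover have "p * p \<le> 2 * m - 1" using pq by simp
    ultimately show ?thesis using m by (simp add: algebra_simps)
  next
    case False
    moreover have "p \<noteq> 4" using odd by auto
    ultimately have "p = 3" using pq by simp
    \<comment> \<open>Here \<open>p * p \<le> 2 * m - 1\<close> is too weak. But
      \<open>m = 6\<close> is excluded, as 3 does not divide 11, so \<open>m \<ge> 8\<close> by
      parity.\<close>
    thus ?thesis using pq m by presburger
  qed
  have eq: "p * (q - 1) = 2 * m - 1 - p" using pq by (simp add: right_diff_distrib')
  have "odd p" using odd by simp
  hence "even (p * (q - 1))" using odd by simp
  moreover have "m + 3 < p * (q - 1)" "p * (q - 1) < 2 * m" using eq \<open>p + 5 \<le> m\<close> by auto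
  ultimately have "coprime (p * (q - 1)) (p * q)" using coprime pq(1) by metis
  thus False using pq(2) by simp
qed

lemma prime_double_plus_one:
  fixes m :: nat
  assumes m: "m \<ge> 6" "even m"
    and coprime: "\<And>n. m + 3 < n \<Longrightarrow> n < 2 * m \<Longrightarrow> odd n \<Longrightarrow> coprime (n - 2) (2 * m + 1)"
  shows "prime (2 * m + 1)"
proof (rule ccontr)
  assume "\<not> prime (2 * m + 1)"
  then obtain p q where pq: "2 * m + 1 = p * q" "3 \<le> p" "p \<le> q"
    using odd_composite_factors[of "2 * m + 1"] m by auto
  have odd: "odd (p * q)" unfolding pq(1)[symmetric] by simp
  \<comment> \<open>The index to test is \<open>p * (q - 2) + 2 = 2 * m + 3 - 2 * p\<close>, which
    exceeds \<open>m + 3\<close> iff \<open>2 * p < m\<close>; evenness of \<open>m\<close> sharpens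
    this to the stated bound. The factor is \<open>q - 2\<close> because the index must be
    odd.\<close>
  have "2 * p + 2 \<le> m"
  proof (cases "p \<ge> 5")
    case True
    then obtain k where "p = 5 + k" using le_Suc_ex by blast
    moreover have "p * p \<le> 2 * m + 1" using pq by simp
    ultimately show ?thesis by (simp add: algebra_simps)
  next
    case False
    moreover have "p \<noteq> 4" using odd by auto
    ultimately have "p = 3" using pq by simp
    thus ?thesis using pq m by presburger
  qed
  have eq: "p * (q - 2) = 2 * m + 1 - 2 * p" using pq by (simp add: right_diff_distrib')
  hence "odd (p * (q - 2) + 2)" using \<open>2 * p + 2 \<le> m\<close> by simp
  moreover have "m + 3 < p * (q - 2) + 2" "p * (q - 2) + 2 < 2 * m"
    using eq \<open>2 * p + 2 \<le> m\<close> pq(2) by auto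
  ultimately have "coprime (p * (q - 2)) (p * q)" using coprime pq(1) by (metis add_diff_cancel_right')
  thus False using pq(2) by simp
qed

theorem theorem2:
  fixes m m' :: nat
  assumes "6 \<le> m"
    and "adjacent_fundamental_points m m'"
    and "{n. m < n \<and> n < m' \<and> cseq n - cseq (n - 1) > 1} = {m + 3}"
  shows "m' = 2 * m \<and>
    (twin_primes (m - 1) (m + 1) \<longrightarrow> twin_primes (m' - 1) (m' + 1))"
proof -
  have cm: "cseq m = 2 * m" and cm': "cseq m' = 2 * m'"
    and between: "\<And>n. m < n \<Longrightarrow> n < m' \<Longrightarrow> cseq n \<noteq> 2 * n"
    using assms(2) by (auto simp: adjacent_fundamental_points_def fundamental_point_def)
  have m3: "m + 3 < m'" using assms(3) by blast
  have one: "cseq n = cseq (n - 1) + 1" if "m < n" "n < m'" "n \<noteq> m + 3" for n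
  proof -
    have "\<not> cseq n - cseq (n - 1) > 1" using that assms(3) by blast
    thus ?thesis using cseq_less[of n] that assms(1) by linarith
  qed
  have c1: "cseq (m + 1) = 2 * m + 1" using one[of "m + 1"] m3 cm by simp
  have c2: "cseq (m + 2) = 2 * m + 2" using one[of "m + 2"] m3 c1 by simp
  have "even m"
  proof (rule ccontr)
    assume "odd m"
    \<comment> \<open>For odd \<open>m\<close>, the increment at \<open>m + 1\<close> would be a gcd
      of two even numbers, yet it is 1.\<close>
    hence "2 dvd gcd (m + 1) (2 * m)" by (intro gcd_greatest) simp_all
    moreover have "gcd (m + 1) (2 * m) = 1"
      using cseq_rec[of "m + 1"] \<open>odd m\<close> assms(1) cm c1 by simp
    ultimately show False by (metis odd_one)
  qed
  \<comment> \<open>As \<open>m + 3\<close> is odd, the main increment is the gcd of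
    \<open>m + 1\<close> and \<open>cseq (m + 2)\<close>.\<close>
  have "m + 1 dvd 2 * m + 2" by (intro dvdI[of _ _ 2]) simp
  hence "gcd (m + 1) (2 * m + 2) = m + 1" by (rule gcd_nat.absorb1)
  hence c3: "cseq (m + 3) = 3 * m + 3"
    using cseq_rec[of "m + 3"] \<open>even m\<close> c2 by (simp add: numeral_3_eq_3)
  have lin: "cseq n = 2 * m + n" if "m + 3 \<le> n" "n < m'" for n
    using that
  proof (induction n rule: dec_induct)
    case base
    show ?case using c3 by simp
  next
    case (step n)
    show ?case using one[of "Suc n"] step by simp
  qed
  \<comment> \<open>Otherwise \<open>lin\<close> would give \<open>cseq (2 * m) = 4 * m\<close>, a
    fundamental point strictly in between.\<close>
  have "m' \<le> 2 * m"
    using between[of "2 * m"] lin[of "2 * m"] assms(1) by fastforce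
  \<comment> \<open>The increment at \<open>m'\<close> itself is not known to be 1, only positive,
    so \<open>2 * m' > 2 * m + (m' - 1)\<close>.\<close>
  moreover have "2 * m \<le> m'"
    using cseq_less[of m'] lin[of "m' - 1"] cm' m3 by simp
  ultimately have m': "m' = 2 * m" by simp
  have gcd1: "(if even n then gcd n (2 * m + (n - 1)) else gcd (n - 2) (2 * m + (n - 1))) = 1"
    if "m + 3 < n" "n < 2 * m" for n
  proof -
    have "cseq (n - 1) = 2 * m + (n - 1)" using lin[of "n - 1"] that m' by linarith
    moreover have "cseq n = cseq (n - 1) + 1" using one[of n] that m' by simp
    moreover have "n \<ge> 2" using that by simp
    ultimately show ?thesis using cseq_rec[of n] by (metis add_left_cancel)
  qed
  have "prime (2 * m - 1)"
  proof (rule prime_double_minus_one)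
    fix n assume n: "m + 3 < n" "n < 2 * m" "even n"
    have "2 * m + (n - 1) = n + (2 * m - 1)" using n by simp
    thus "coprime n (2 * m - 1)" using gcd1[OF n(1,2)] n(3)
      by (metis coprime_iff_gcd_eq_1 gcd_add2)
  qed (use assms(1) \<open>even m\<close> in auto)
  moreover have "prime (2 * m + 1)"
  proof (rule prime_double_plus_one)
    fix n assume n: "m + 3 < n" "n < 2 * m" "odd n"
    have "2 * m + (n - 1) = (n - 2) + (2 * m + 1)" using n by simp
    thus "coprime (n - 2) (2 * m + 1)" using gcd1[OF n(1,2)] n(3)
      by (metis coprime_iff_gcd_eq_1 gcd_add2)
  qed (use assms(1) \<open>even m\<close> in auto)
  ultimately show ?thesis using m' assms(1) by (simp add: twin_primes_def)
qed

end
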